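(* Let $n\ge 1$, let $k_1,\dots,k_n$ be positive integers and let $X$ be a complete $\mathrm{CAT}(0)$ space of dimension less than $k_1+\dots+k_n$. Let $S_1,\dots,S_n\subseteq\mathrm{Isom}(X)$ be subsets with $[s_i,s_j]=1$ for all $s_i\in S_i$ and $s_j\in S_j$ whenever $i\ne j$. If, for $i=1,\dots,n$, each subset of $S_i$ with at most $k_i$ elements has a fixed point in $X$, then for some $i\in\{1,\dots,n\}$ every finite subset of $S_i$ has a fixed point in $X$.
   Context: A subset $T\subseteq\mathrm{Isom}(X)$ has a fixed point if there is $x\in X$ with $tx=x$ for all $t\in T$ (equivalently, the subgroup generated by $T$ fixes a point). $\mathrm{CAT}(0)$ spaces are non-empty and not assumed locally compact. Dimension means topological covering dimension: $\dim(X)\le d$ if for every closed subspace $K\subseteq X$ and every $r\ge d$, every continuous map $K\to\mathbb{S}^r$ to the $r$-sphere extends to a continuous map $X\to\mathbb{S}^r$. *)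

theory Defs
  imports
    "HOL-Analysis.Analysis"
    "HOL-Library.Extended_Nat"
begin

definition geodesic_segment :: "'a::metric_space set \<Rightarrow> 'a \<Rightarrow> 'a \<Rightarrow> bool" where
  "geodesic_segment G x y \<longleftrightarrow>
     (\<exists>c::real \<Rightarrow> 'a. c 0 = x \<and> c (dist x y) = y \<and>
        (\<forall>s\<in>{0..dist x y}. \<forall>t\<in>{0..dist x y}. dist (c s) (c t) = \<bar>s - t\<bar>) \<and>
        G = c ` {0..dist x y})"

definition geodesic_triangle ::
    "'a::metric_space \<Rightarrow> 'a \<Rightarrow> 'a \<Rightarrow> 'a set \<Rightarrow> 'a set \<Rightarrow> 'a set \<Rightarrow> bool" where
  "geodesic_triangle p q r A B C \<longleftrightarrow>
     geodesic_segment A p q \<and> geodesic_segment B q r \<and> geodesic_segment C r p"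

definition comparison_triangle ::
    "'a::metric_space \<Rightarrow> 'a \<Rightarrow> 'a \<Rightarrow> real^2 \<Rightarrow> real^2 \<Rightarrow> real^2 \<Rightarrow> bool" where
  "comparison_triangle p q r p' q' r' \<longleftrightarrow>
     dist p' q' = dist p q \<and> dist q' r' = dist q r \<and> dist r' p' = dist r p"

definition comparison_point ::
    "'a::metric_space set \<Rightarrow> 'a \<Rightarrow> real^2 \<Rightarrow> real^2 \<Rightarrow> 'a \<Rightarrow> real^2 \<Rightarrow> bool" where
  "comparison_point G a a' b' x x' \<longleftrightarrow>
     x \<in> G \<and> x' \<in> closed_segment a' b' \<and> dist a' x' = dist a x"

definition triangle_comparison_point ::
    "'a::metric_space \<Rightarrow> 'a \<Rightarrow> 'a \<Rightarrow> 'a set \<Rightarrow> 'a set \<Rightarrow> 'a set \<Rightarrow>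
     real^2 \<Rightarrow> real^2 \<Rightarrow> real^2 \<Rightarrow> 'a \<Rightarrow> real^2 \<Rightarrow> bool" where
  "triangle_comparison_point p q r A B C p' q' r' x x' \<longleftrightarrow>
     comparison_point A p p' q' x x' \<or>
     comparison_point B q q' r' x x' \<or>
     comparison_point C r r' p' x x'"

text \<open>The whole type is the space, so it is automatically non-empty; completeness is not
  part of the class.\<close>

class cat0_space = metric_space +
  assumes geodesic_space: "\<exists>G. geodesic_segment G x y"
    and cat0_inequality:
      "geodesic_triangle p q r A B C \<Longrightarrow> comparison_triangle p q r p' q' r' \<Longrightarrow>
       triangle_comparison_point p q r A B C p' q' r' x x' \<Longrightarrow>
       triangle_comparison_point p q r A B C p' q' r' y y' \<Longrightarrow>
       dist x y \<le> dist x' y'"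

text \<open>Covering dimension by extension of maps to spheres. The value \<open>\<infinity>\<close> arises as the infimum
  of the empty set. The empty space, usually of dimension \<open>- 1\<close>, gets \<open>0\<close> here.\<close>

definition covering_dim_le :: "'a topology \<Rightarrow> nat \<Rightarrow> bool" where
  "covering_dim_le X d \<longleftrightarrow>
     (\<forall>K r f. closedin X K \<longrightarrow> d \<le> r \<longrightarrow> continuous_map (subtopology X K) (nsphere r) f \<longrightarrow>
        (\<exists>g. continuous_map X (nsphere r) g \<and> (\<forall>x\<in>K. g x = f x)))"

definition covering_dim :: "'a topology \<Rightarrow> enat" where
  "covering_dim X = (INF d\<in>{d. covering_dim_le X d}. enat d)"

definition Isom :: "('a::metric_space \<Rightarrow> 'a) set" where
  "Isom = {f. bij f \<and> (\<forall>x y. dist (f x) (f y) = dist x y)}"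

definition has_fixed_point :: "('a \<Rightarrow> 'a) set \<Rightarrow> bool" where
  "has_fixed_point T \<longleftrightarrow> (\<exists>x. \<forall>t\<in>T. t x = x)"

end

theory Submission
  imports Defs "HOL-Homology.Brouwer_Degree"
begin

text \<open>
  Suppose that every \<open>S\<^sub>i\<close> has a finite subset without a fixed point, and let
  \<open>T\<^sub>i\<close> be a minimal one. It has \<open>m\<^sub>i + 1\<close> elements with
  \<open>m\<^sub>i \<ge> k\<^sub>i\<close>, so \<open>X\<close> has dimension at most \<open>d = m\<^sub>1 + \<dots> + m\<^sub>n - 1\<close>.
  The product \<open>P\<close> of the \<open>n\<close> simplices with vertex sets \<open>T\<^sub>i\<close> has dimension \<open>d + 1\<close> and
  its boundary is a \<open>d\<close>-sphere; the fixed point sets in \<open>X\<close> reproduce this sphere.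

  A vertex of \<open>P\<close> picks an \<open>s\<^sub>i\<close> from each \<open>T\<^sub>i\<close>. By minimality each
  \<open>T\<^sub>i - {s\<^sub>i}\<close> has a fixed point, and because different families commute, all these sets
  have a common one (\<open>commuting_family_fixed_point\<close>): projecting a fixed point of one set onto
  the fixed set of another one keeps it fixed. Weighted barycentres of the points so attached to
  the vertices extend the choice to a continuous map \<open>P \<rightarrow> X\<close>
  (\<open>continuous_on_barycenter\<close>). A barycentre is unique, hence fixed by every isometry that fixes
  all points of positive weight (\<open>barycenter_fixed\<close>). So a point of \<open>P\<close> whose barycentric
  coordinate at \<open>s\<close> vanishes goes to a point fixed by \<open>s\<close>.

  Conversely, the displacements \<open>dist x (s x)\<close> give for each \<open>i\<close> a nonzero vector of coordinates
  indexed by \<open>T\<^sub>i\<close>. On the closed set \<open>K\<close> of points fixed by at least one \<open>s\<close> they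
  define a map \<open>f\<close> from \<open>K\<close> to the boundary of \<open>P\<close>, seen as the unit sphere of dimension \<open>d\<close>.
  The dimension bound extends \<open>f\<close> to all of \<open>X\<close>. Composing \<open>P \<rightarrow> X\<close> with this extension and
  restricting to the boundary of \<open>P\<close> gives a self-map of the sphere that is null-homotopic,
  since it extends over \<open>P\<close>. But it maps each proper face of \<open>P\<close> to itself, because vanishing
  weights become vanishing displacements; so no point goes to its antipode, and such a
  self-map of a sphere is homotopic to the identity
  (\<open>nullhomotopic_nsphere_antipode\<close>). That is impossible as spheres are not contractible.

  The CAT(0) condition enters only through the midpoint inequality of Bruhat and Tits.
\<close>

section \<open>Midpoints in CAT(0) spaces\<close>

text \<open>The inequality of Bruhat and Tits, which determines the midpoint \<open>m\<close> of \<open>x\<close> and \<open>y\<close>: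
  taking \<open>z = x\<close> and \<open>z = y\<close> gives that \<open>m\<close> has distance at most \<open>dist x y / 2\<close> from both.\<close>

definition cat0_midpoint :: "'a::metric_space \<Rightarrow> 'a \<Rightarrow> 'a \<Rightarrow> bool" where
  "cat0_midpoint m x y \<longleftrightarrow>
     (\<forall>z. (dist z m)\<^sup>2 \<le> (dist z x)\<^sup>2 / 2 + (dist z y)\<^sup>2 / 2 - (dist x y)\<^sup>2 / 4)"

lemma comparison_triangle_exists:
  fixes p q r :: "'a::metric_space"
  obtains p' q' r' where "comparison_triangle p q r p' q' r'"
proof -
  define a b c where "a = dist p q" and "b = dist q r" and "c = dist r p"
  have nonneg: "0 \<le> a" "0 \<le> b" "0 \<le> c"
    by (auto simp: a_def b_def c_def)
  have tri: "b \<le> a + c" "a \<le> b + c" "c \<le> a + b"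
    unfolding a_def b_def c_def by (metis dist_commute dist_triangle add.commute)+
  have dist2: "dist (vector [s, t] :: real^2) (vector [u, v]) = sqrt ((s - u)\<^sup>2 + (t - v)\<^sup>2)"
    for s t u v
    by (simp add: dist_vec_def L2_set_def sum_2 dist_real_def)
  show thesis
  proof (cases "a = 0")
    case True
    then have "b = c"
      using tri by auto
    then have "comparison_triangle p q r (vector [0, 0]) (vector [0, 0]) (vector [c, 0])"
      using True nonneg by (simp add: comparison_triangle_def dist2 flip: a_def b_def c_def)
    then show thesis ..
  next
    case False
    then have "a > 0"
      using nonneg by auto
    \<comment> \<open>\<open>p'\<close> is the origin and \<open>q'\<close> lies on the first axis; the law of cosines
      gives the first coordinate \<open>u\<close> of \<open>r'\<close>.\<close>
    define u where "u = (a\<^sup>2 + c\<^sup>2 - b\<^sup>2) / (2 * a)"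
    have au: "2 * a * u = a\<^sup>2 + c\<^sup>2 - b\<^sup>2"
      using \<open>a > 0\<close> by (simp add: u_def)
    have "b\<^sup>2 \<le> (a + c)\<^sup>2"
      using tri nonneg by (intro power_mono) auto
    then have 1: "2 * a * (- u) \<le> 2 * a * c"
      using au by (simp add: power2_sum algebra_simps)
    have "(a - c)\<^sup>2 \<le> b\<^sup>2"
      using tri nonneg by (intro abs_le_square_iff[THEN iffD1]) auto
    then have 2: "2 * a * u \<le> 2 * a * c"
      using au by (simp add: power2_diff algebra_simps)
    have "- u \<le> c" "u \<le> c"
      using mult_left_le_imp_le[OF 1] mult_left_le_imp_le[OF 2] \<open>a > 0\<close> by simp_all
    then have "\<bar>u\<bar> \<le> \<bar>c\<bar>"
      by linarith
    then have uc: "u\<^sup>2 \<le> c\<^sup>2"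
      by (simp add: abs_le_square_iff)
    have "(a - u)\<^sup>2 + (c\<^sup>2 - u\<^sup>2) = b\<^sup>2"
      using au by (simp add: power2_diff algebra_simps)
    then have "comparison_triangle p q r (vector [0, 0]) (vector [a, 0])
        (vector [u, sqrt (c\<^sup>2 - u\<^sup>2)])"
      using nonneg uc
      by (simp add: comparison_triangle_def dist2 flip: a_def b_def c_def)
    then show thesis ..
  qed
qed

lemma parallelogram_law_diff:
  fixes a b :: "'a::real_inner"
  shows "(norm (a + b))\<^sup>2 = 2 * (norm a)\<^sup>2 + 2 * (norm b)\<^sup>2 - (norm (b - a))\<^sup>2"
  unfolding power2_norm_eq_inner
  by (simp add: inner_add_left inner_add_right inner_diff_left inner_diff_right inner_commute)

text \<open>The midpoint of a geodesic works: comparison with the Euclidean triangle on \<open>z, x, y\<close>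
  bounds \<open>dist z m\<close> by the length of a Euclidean median, which the parallelogram law computes.\<close>

lemma cat0_midpoint_exists:
  fixes x y :: "'a::cat0_space"
  obtains m where "cat0_midpoint m x y"
proof -
  obtain B where B: "geodesic_segment B x y"
    using geodesic_space by blast
  then obtain c where c: "c 0 = x" "c (dist x y) = y"
      "\<And>s t. s \<in> {0..dist x y} \<Longrightarrow> t \<in> {0..dist x y} \<Longrightarrow> dist (c s) (c t) = \<bar>s - t\<bar>"
      "B = c ` {0..dist x y}"
    unfolding geodesic_segment_def by blast
  define m where "m = c (dist x y / 2)"
  have "m \<in> B"
    unfolding m_def c(4) by (intro imageI) auto
  have xm: "dist x m = dist x y / 2"
    using c(3)[of 0 "dist x y / 2"] c(1) by (simp add: m_def)
  have "(dist z m)\<^sup>2 \<le> (dist z x)\<^sup>2 / 2 + (dist z y)\<^sup>2 / 2 - (dist x y)\<^sup>2 / 4" for z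
  proof -
    obtain A where A: "geodesic_segment A z x"
      using geodesic_space by blast
    obtain C where C: "geodesic_segment C y z"
      using geodesic_space by blast
    have "z \<in> A"
      using A unfolding geodesic_segment_def by force
    obtain z' x' y' where t: "comparison_triangle z x y z' x' y'"
      by (rule comparison_triangle_exists)
    then have d: "dist z' x' = dist z x" "dist x' y' = dist x y" "dist y' z' = dist y z"
      by (auto simp: comparison_triangle_def)
    have mid: "dist x' (midpoint x' y') = dist x y / 2"
      using d by (simp add: dist_midpoint)
    have "dist z m \<le> dist z' (midpoint x' y')"
    proof (rule cat0_inequality)
      show "geodesic_triangle z x y A B C"
        using A B C by (simp add: geodesic_triangle_def)
      show "triangle_comparison_point z x y A B C z' x' y' z z'"
        using \<open>z \<in> A\<close> by (simp add: triangle_comparison_point_def comparison_point_def)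
      show "triangle_comparison_point z x y A B C z' x' y' m (midpoint x' y')"
        using \<open>m \<in> B\<close> xm mid
        by (simp add: triangle_comparison_point_def comparison_point_def)
    qed (fact t)
    then have "(dist z m)\<^sup>2 \<le> (dist z' (midpoint x' y'))\<^sup>2"
      by (simp add: power_mono)
    also have "\<dots> = (dist z' x')\<^sup>2 / 2 + (dist z' y')\<^sup>2 / 2 - (dist x' y')\<^sup>2 / 4"
    proof -
      have "z' - midpoint x' y' = (1/2) *\<^sub>R ((z' - x') + (z' - y'))"
        by (simp add: vec_eq_iff midpoint_def field_simps)
      then have "(dist z' (midpoint x' y'))\<^sup>2 = (norm ((z' - x') + (z' - y')))\<^sup>2 / 4"
        by (simp add: dist_norm power_divide)
      also have "\<dots> = (norm (z' - x'))\<^sup>2 / 2 + (norm (z' - y'))\<^sup>2 / 2 - (norm ((z' - y') - (z' - x')))\<^sup>2 / 4"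
        using parallelogram_law_diff[of "z' - x'" "z' - y'"] by simp
      finally show ?thesis
        by (simp add: dist_norm)
    qed
    finally show ?thesis
      using d by (simp add: dist_commute)
  qed
  then show thesis
    using that by (auto simp: cat0_midpoint_def)
qed

text \<open>\<open>t m\<close> is no farther from \<open>x\<close> and \<open>y\<close> than \<open>m\<close>, and the midpoint inequality at \<open>z = t m\<close>
  leaves no room for a second such point.\<close>

lemma cat0_midpoint_fixed:
  assumes m: "cat0_midpoint m x y" and "t \<in> Isom" "t x = x" "t y = y"
  shows "t m = m"
proof -
  have isom: "dist (t u) (t v) = dist u v" for u v
    using \<open>t \<in> Isom\<close> by (simp add: Isom_def)
  have "dist (t m) x = dist x m" "dist (t m) y = dist y m"
    using isom assms by (metis dist_commute)+
  moreover have "(dist x m)\<^sup>2 \<le> (dist x y)\<^sup>2 / 4" "(dist y m)\<^sup>2 \<le> (dist x y)\<^sup>2 / 4"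
    using m[unfolded cat0_midpoint_def, rule_format, of x]
      m[unfolded cat0_midpoint_def, rule_format, of y]
    by (auto simp: dist_commute)
  moreover have "(dist (t m) m)\<^sup>2
      \<le> (dist (t m) x)\<^sup>2 / 2 + (dist (t m) y)\<^sup>2 / 2 - (dist x y)\<^sup>2 / 4"
    using m by (simp add: cat0_midpoint_def)
  ultimately have "(dist (t m) m)\<^sup>2
      \<le> ((dist x y)\<^sup>2 / 4) / 2 + ((dist x y)\<^sup>2 / 4) / 2 - (dist x y)\<^sup>2 / 4"
    by (smt (verit) divide_right_mono)
  then have "(dist (t m) m)\<^sup>2 \<le> 0"
    by simp
  then show ?thesis
    by simp
qed

section \<open>Minimising weighted sums of squared distances\<close>

text \<open>Minimising over a closed convex set with a single point \<open>p\<close> gives nearest-point projection;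
  minimising over the whole space gives weighted barycentres. Both are needed, and the weights
  are not normalised so that they may come as products.\<close>

definition energy :: "'b set \<Rightarrow> ('b \<Rightarrow> real) \<Rightarrow> ('b \<Rightarrow> 'a::metric_space) \<Rightarrow> 'a \<Rightarrow> real" where
  "energy A w p x = (\<Sum>a\<in>A. w a * (dist x (p a))\<^sup>2)"

definition midpoint_convex :: "'a::metric_space set \<Rightarrow> bool" where
  "midpoint_convex C \<longleftrightarrow> (\<forall>x\<in>C. \<forall>y\<in>C. \<forall>m. cat0_midpoint m x y \<longrightarrow> m \<in> C)"

lemma energy_nonneg: "(\<And>a. a \<in> A \<Longrightarrow> 0 \<le> w a) \<Longrightarrow> 0 \<le> energy A w p x"
  by (simp add: energy_def sum_nonneg)

lemma energy_midpoint:
  assumes "cat0_midpoint m x y" and "\<And>a. a \<in> A \<Longrightarrow> 0 \<le> w a"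
  shows "energy A w p m \<le> energy A w p x / 2 + energy A w p y / 2 - sum w A * (dist x y)\<^sup>2 / 4"
proof -
  have "energy A w p m \<le> (\<Sum>a\<in>A. w a *
      ((dist x (p a))\<^sup>2 / 2 + (dist y (p a))\<^sup>2 / 2 - (dist x y)\<^sup>2 / 4))"
    unfolding energy_def
  proof (intro sum_mono mult_left_mono)
    fix a
    show "(dist m (p a))\<^sup>2 \<le> (dist x (p a))\<^sup>2 / 2 + (dist y (p a))\<^sup>2 / 2 - (dist x y)\<^sup>2 / 4"
      using assms(1)[unfolded cat0_midpoint_def, rule_format, of "p a"]
      by (simp add: dist_commute)
  qed (use assms in auto)
  also have "\<dots> = energy A w p x / 2 + energy A w p y / 2 - sum w A * (dist x y)\<^sup>2 / 4"
    by (simp add: energy_def algebra_simps sum.distrib sum_subtractf sum_divide_distrib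
        sum_distrib_left sum_distrib_right)
  finally show ?thesis .
qed

text \<open>Uniform convexity: almost minimal points are close together, because the energy of their
  midpoint cannot drop below the infimum. Existence, uniqueness and stability of minimisers all
  come from this estimate.\<close>

lemma energy_gap:
  fixes p :: "'b \<Rightarrow> 'a::cat0_space"
  assumes "midpoint_convex C" and "x \<in> C" "y \<in> C" and "\<And>a. a \<in> A \<Longrightarrow> 0 \<le> w a"
    and inf: "\<And>z. z \<in> C \<Longrightarrow> e \<le> energy A w p z"
  shows "sum w A * (dist x y)\<^sup>2 \<le> 2 * (energy A w p x - e) + 2 * (energy A w p y - e)"
proof -
  obtain m where m: "cat0_midpoint m x y"
    by (rule cat0_midpoint_exists)
  then have "m \<in> C"
    using assms(1-3) unfolding midpoint_convex_def by blast
  then have "e \<le> energy A w p m"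
    by (rule inf)
  then show ?thesis
    using energy_midpoint[where A = A and p = p and w = w, OF m assms(4)] by simp
qed

text \<open>The sets of points with energy within \<open>1 / (n + 1)\<close> of the infimum \<open>e\<close> are nested, and
  their diameters tend to zero.\<close>

lemma energy_minimizer_exists:
  fixes p :: "'b \<Rightarrow> 'a::{cat0_space, complete_space}"
  assumes C: "closed C" "C \<noteq> {}" "midpoint_convex C"
    and w: "\<And>a. a \<in> A \<Longrightarrow> 0 \<le> w a" "0 < sum w A"
  obtains x where "x \<in> C" "\<And>y. y \<in> C \<Longrightarrow> energy A w p x \<le> energy A w p y"
proof -
  define e where "e = Inf (energy A w p ` C)"
  have bdd: "bdd_below (energy A w p ` C)"
    using energy_nonneg[OF w(1), where p = p] by (intro bdd_belowI[of _ 0]) auto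
  have e: "e \<le> energy A w p z" if "z \<in> C" for z
    unfolding e_def using bdd that by (simp add: cINF_lower)
  define N where "N n = {x \<in> C. energy A w p x \<le> e + 1 / real (Suc n)}" for n
  have cont: "continuous_on UNIV (energy A w p)"
    unfolding energy_def by (intro continuous_intros)
  obtain x where x: "\<And>n. x \<in> N n"
  proof (rule decreasing_closed_nest)
    fix n
    have "N n = C \<inter> {x. energy A w p x \<le> e + 1 / real (Suc n)}"
      by (auto simp: N_def)
    then show "closed (N n)"
      using C(1) cont by (auto intro!: closed_Int closed_Collect_le)
    have "\<exists>v\<in>energy A w p ` C. v < e + 1 / real (Suc n)"
      using C(2) by (intro cInf_lessD) (auto simp: e_def)
    then show "N n \<noteq> {}"
      by (auto simp: N_def intro: less_imp_le)
  next
    fix m n :: nat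
    assume "m \<le> n"
    then have "1 / real (Suc n) \<le> 1 / real (Suc m)"
      by (simp add: frac_le)
    then show "N n \<subseteq> N m"
      by (auto simp: N_def)
  next
    fix \<epsilon> :: real
    assume "\<epsilon> > 0"
    then have "0 < sum w A * \<epsilon>\<^sup>2 / 4"
      using w by simp
    then obtain n where n: "1 / real (Suc n) < sum w A * \<epsilon>\<^sup>2 / 4"
      using nat_approx_posE by blast
    have "dist x y < \<epsilon>" if "x \<in> N n" "y \<in> N n" for x y
    proof -
      have "sum w A * (dist x y)\<^sup>2 \<le> 2 * (energy A w p x - e) + 2 * (energy A w p y - e)"
        using that by (intro energy_gap[OF C(3)] e w) (auto simp: N_def)
      also have "\<dots> < sum w A * \<epsilon>\<^sup>2"
        using that n by (simp add: N_def)
      finally have "(dist x y)\<^sup>2 < \<epsilon>\<^sup>2"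
        using w by simp
      then show ?thesis
        using \<open>\<epsilon> > 0\<close> by (simp add: power_less_imp_less_base)
    qed
    then show "\<exists>n. \<forall>x\<in>N n. \<forall>y\<in>N n. dist x y < \<epsilon>"
      by blast
  qed blast
  have "(\<lambda>n. e + 1 / real (Suc n)) \<longlonglongrightarrow> e + 0"
    by (intro tendsto_add tendsto_const LIMSEQ_Suc lim_1_over_n)
  then have "energy A w p x \<le> e"
    using x by (intro LIMSEQ_le_const[of "\<lambda>n. e + 1 / real (Suc n)" e]) (auto simp: N_def)
  then have "energy A w p x \<le> energy A w p y" if "y \<in> C" for y
    using e[OF that] by linarith
  moreover have "x \<in> C"
    using x[of 0] by (simp add: N_def)
  ultimately show thesis
    using that by blast
qed

definition barycenter ::
    "'b set \<Rightarrow> ('b \<Rightarrow> real) \<Rightarrow> ('b \<Rightarrow> 'a::metric_space) \<Rightarrow> 'a" where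
  "barycenter A w p = (SOME x. \<forall>y. energy A w p x \<le> energy A w p y)"

context
  fixes A :: "'b set" and w :: "'b \<Rightarrow> real" and p :: "'b \<Rightarrow> 'a::{cat0_space, complete_space}"
  assumes w: "\<And>a. a \<in> A \<Longrightarrow> 0 \<le> w a" "0 < sum w A"
begin

lemma energy_barycenter_le: "energy A w p (barycenter A w p) \<le> energy A w p y"
proof -
  obtain x where "\<And>y. energy A w p x \<le> energy A w p y"
    by (rule energy_minimizer_exists[of UNIV A w p]) (use w in \<open>auto simp: midpoint_convex_def\<close>)
  then have "\<exists>x. \<forall>y. energy A w p x \<le> energy A w p y"
    by blast
  from someI_ex[OF this] show ?thesis
    by (simp add: barycenter_def)
qed

lemma dist_barycenter_le:
  "sum w A * (dist y (barycenter A w p))\<^sup>2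
     \<le> 2 * (energy A w p y - energy A w p (barycenter A w p))"
proof -
  have "midpoint_convex (UNIV :: 'a set)"
    by (simp add: midpoint_convex_def)
  from energy_gap[OF this UNIV_I UNIV_I w(1) energy_barycenter_le, of y "barycenter A w p"]
  show ?thesis
    by simp
qed

text \<open>\<open>t\<close> preserves the energy of the barycentre, which is the only minimiser.\<close>

lemma barycenter_fixed:
  assumes "t \<in> Isom" and fixed: "\<And>a. a \<in> A \<Longrightarrow> w a \<noteq> 0 \<Longrightarrow> t (p a) = p a"
  shows "t (barycenter A w p) = barycenter A w p" (is "t ?b = ?b")
proof -
  have "w a * (dist (t ?b) (p a))\<^sup>2 = w a * (dist ?b (p a))\<^sup>2" if "a \<in> A" for a
  proof (cases "w a = 0")
    case False
    have "dist (t ?b) (t (p a)) = dist ?b (p a)"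
      using \<open>t \<in> Isom\<close> by (simp add: Isom_def)
    then show ?thesis
      using fixed[OF that False] by simp
  qed simp
  then have "energy A w p (t ?b) = energy A w p ?b"
    unfolding energy_def by (rule sum.cong[OF refl])
  then have "sum w A * (dist (t ?b) ?b)\<^sup>2 \<le> 0"
    using dist_barycenter_le[of "t ?b"] by simp
  then show ?thesis
    using w by (simp add: mult_le_0_iff)
qed

text \<open>If the barycentre were at distance more than \<open>D\<close> from every \<open>p a\<close>, any of the points
  \<open>p b\<close> would have less energy. The bound does not depend on the weights, which is what continuity
  in the weights needs.\<close>

lemma barycenter_in_bounded:
  assumes D: "\<And>a b. a \<in> A \<Longrightarrow> b \<in> A \<Longrightarrow> dist (p a) (p b) \<le> D" and "b \<in> A"
  shows "dist (barycenter A w p) (p b) \<le> 2 * D"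
proof -
  have "\<exists>a\<in>A. dist (barycenter A w p) (p a) \<le> D"
  proof (rule ccontr)
    assume "\<not> ?thesis"
    then have far: "D < dist (barycenter A w p) (p a)" if "a \<in> A" for a
      using that by force
    have "0 \<le> D"
      using D[OF \<open>b \<in> A\<close> \<open>b \<in> A\<close>] by simp
    have pos: "\<exists>a\<in>A. 0 < w a"
      using w by (meson linorder_not_le sum_nonpos)
    have "finite A"
      using w by (metis less_irrefl sum.infinite)
    have "energy A w p (p b) \<le> (\<Sum>a\<in>A. w a * D\<^sup>2)"
      unfolding energy_def using w D \<open>b \<in> A\<close>
      by (intro sum_mono mult_left_mono power_mono) auto
    also have "\<dots> < energy A w p (barycenter A w p)"
      unfolding energy_def
    proof (rule sum_strict_mono_ex1)
      show "\<forall>a\<in>A. w a * D\<^sup>2 \<le> w a * (dist (barycenter A w p) (p a))\<^sup>2"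
        using w far \<open>0 \<le> D\<close> by (simp add: mult_left_mono power_mono less_imp_le)
      show "\<exists>a\<in>A. w a * D\<^sup>2 < w a * (dist (barycenter A w p) (p a))\<^sup>2"
      proof -
        obtain a where a: "a \<in> A" "0 < w a"
          using pos ..
        then have "D\<^sup>2 < (dist (barycenter A w p) (p a))\<^sup>2"
          using far \<open>0 \<le> D\<close> by (intro power_strict_mono) auto
        then have "w a * D\<^sup>2 < w a * (dist (barycenter A w p) (p a))\<^sup>2"
          using a by simp
        with a(1) show ?thesis ..
      qed
    qed (fact \<open>finite A\<close>)
    finally show False
      using energy_barycenter_le[of "p b"] by simp
  qed
  then obtain a where "a \<in> A" "dist (barycenter A w p) (p a) \<le> D" ..
  then show ?thesis
    using D[OF \<open>a \<in> A\<close> \<open>b \<in> A\<close>] dist_triangle[of "barycenter A w p" "p b" "p a"] by simp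
qed

end

text \<open>The barycentre for \<open>w z\<close> nearly minimises the energy for \<open>w z0\<close>, since on the bounded region
  that contains all barycentres the two energies differ by a multiple of the change of weights.
  By \<open>dist_barycenter_le\<close> it is then close to the barycentre for \<open>w z0\<close>.\<close>

lemma continuous_on_barycenter:
  fixes p :: "'b \<Rightarrow> 'a::{cat0_space, complete_space}"
    and w :: "'z::topological_space \<Rightarrow> 'b \<Rightarrow> real"
  assumes fin: "finite A"
    and cont: "\<And>a. a \<in> A \<Longrightarrow> continuous_on S (\<lambda>z. w z a)"
    and nonneg: "\<And>z a. z \<in> S \<Longrightarrow> a \<in> A \<Longrightarrow> 0 \<le> w z a"
    and pos: "\<And>z. z \<in> S \<Longrightarrow> 0 < sum (w z) A"
  shows "continuous_on S (\<lambda>z. barycenter A (w z) p)"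
  unfolding continuous_on
proof
  fix z0
  assume z0: "z0 \<in> S"
  define b where "b z = barycenter A (w z) p" for z
  \<comment> \<open>A crude bound for the diameter of \<open>p ` A\<close> that also makes sense for empty \<open>A\<close>.\<close>
  define D where "D = (\<Sum>a\<in>A. \<Sum>b\<in>A. dist (p a) (p b))"
  have D: "dist (p a) (p b) \<le> D" if "a \<in> A" "b \<in> A" for a b
  proof -
    have "dist (p a) (p b) \<le> (\<Sum>b\<in>A. dist (p a) (p b))"
      using that fin by (intro member_le_sum) auto
    also have "\<dots> \<le> D"
      unfolding D_def using that fin by (intro member_le_sum) (auto intro: sum_nonneg)
    finally show ?thesis .
  qed
  have bound: "(dist (b z) (p a))\<^sup>2 \<le> (2 * D)\<^sup>2" if "z \<in> S" "a \<in> A" for z a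
    unfolding b_def using that nonneg pos D
    by (intro power_mono barycenter_in_bounded) auto
  have key: "sum (w z0) A * (dist (b z) (b z0))\<^sup>2
      \<le> 2 * (\<Sum>a\<in>A. \<bar>w z a - w z0 a\<bar> * (2 * D)\<^sup>2)" if z: "z \<in> S" for z
  proof -
    have "sum (w z0) A * (dist (b z) (b z0))\<^sup>2
        \<le> 2 * (energy A (w z0) p (b z) - energy A (w z0) p (b z0))"
      unfolding b_def using nonneg pos z0 by (intro dist_barycenter_le) auto
    \<comment> \<open>The subtracted term is not positive as \<open>b z\<close> minimises the energy for \<open>w z\<close>; with it,
      only differences of weights remain.\<close>
    also have "\<dots> \<le> 2 * ((energy A (w z0) p (b z) - energy A (w z0) p (b z0))
        - (energy A (w z) p (b z) - energy A (w z) p (b z0)))"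
      using energy_barycenter_le[of A "w z" p "b z0"] nonneg pos z by (simp add: b_def)
    also have "\<dots> = 2 * (\<Sum>a\<in>A. (w z a - w z0 a) *
        ((dist (b z0) (p a))\<^sup>2 - (dist (b z) (p a))\<^sup>2))"
      by (simp add: energy_def algebra_simps sum.distrib sum_subtractf)
    also have "\<dots> \<le> 2 * (\<Sum>a\<in>A. \<bar>w z a - w z0 a\<bar> * (2 * D)\<^sup>2)"
    proof (intro mult_left_mono sum_mono)
      fix a
      assume a: "a \<in> A"
      have "\<bar>(dist (b z0) (p a))\<^sup>2 - (dist (b z) (p a))\<^sup>2\<bar> \<le> (2 * D)\<^sup>2"
        using bound[OF z a] bound[OF z0 a]
          zero_le_power2[of "dist (b z0) (p a)"] zero_le_power2[of "dist (b z) (p a)"]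
        by linarith
      then have "\<bar>(w z a - w z0 a) * ((dist (b z0) (p a))\<^sup>2 - (dist (b z) (p a))\<^sup>2)\<bar>
          \<le> \<bar>w z a - w z0 a\<bar> * (2 * D)\<^sup>2"
        unfolding abs_mult by (intro mult_left_mono) auto
      then show "(w z a - w z0 a) * ((dist (b z0) (p a))\<^sup>2 - (dist (b z) (p a))\<^sup>2)
          \<le> \<bar>w z a - w z0 a\<bar> * (2 * D)\<^sup>2"
        by linarith
    qed simp
    finally show ?thesis .
  qed
  define \<rho> where "\<rho> z = sqrt (2 * (\<Sum>a\<in>A. \<bar>w z a - w z0 a\<bar> * (2 * D)\<^sup>2) / sum (w z0) A)" for z
  have "dist (b z) (b z0) \<le> \<rho> z" if "z \<in> S" for z
    unfolding \<rho>_def using key[OF that] pos[OF z0]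
    by (intro real_le_rsqrt) (simp add: field_simps)
  then have le: "\<forall>\<^sub>F z in at z0 within S. dist (b z) (b z0) \<le> \<rho> z"
    unfolding eventually_at_topological by blast
  have "continuous_on S \<rho>"
    unfolding \<rho>_def using cont pos[OF z0] by (intro continuous_intros) auto
  then have "(\<rho> \<longlongrightarrow> \<rho> z0) (at z0 within S)"
    using z0 by (simp add: continuous_on)
  then have lim: "(\<rho> \<longlongrightarrow> 0) (at z0 within S)"
    by (simp add: \<rho>_def)
  have "((\<lambda>z. dist (b z) (b z0)) \<longlongrightarrow> 0) (at z0 within S)"
    by (rule tendsto_sandwich[OF _ le tendsto_const lim]) simp
  then show "((\<lambda>z. barycenter A (w z) p) \<longlongrightarrow> barycenter A (w z0) p) (at z0 within S)"
    unfolding b_def by (rule tendsto_dist_iff[THEN iffD2])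
qed

section \<open>Fixed points of commuting sets of isometries\<close>

lemma Isom_continuous_on: "t \<in> Isom \<Longrightarrow> continuous_on S t"
proof -
  assume "t \<in> Isom"
  then have "1-lipschitz_on S t"
    by (simp add: Isom_def lipschitz_on_def)
  then show ?thesis
    by (rule lipschitz_on_continuous_on)
qed

lemma common_fixed_points_closed:
  fixes A :: "('a::metric_space \<Rightarrow> 'a) set"
  assumes "A \<subseteq> Isom"
  shows "closed {x. \<forall>t\<in>A. t x = x}"
proof -
  have "continuous_on UNIV t" if "t \<in> A" for t
    using that assms by (auto intro: Isom_continuous_on)
  then have "closed (\<Inter>t\<in>A. {x. t x = x})"
    by (intro closed_INT ballI closed_Collect_eq continuous_intros) auto
  moreover have "(\<Inter>t\<in>A. {x. t x = x}) = {x. \<forall>t\<in>A. t x = x}"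
    by auto
  ultimately show ?thesis
    by simp
qed

text \<open>Let \<open>q\<close> be fixed by \<open>B\<close> and \<open>x\<close> its projection to the fixed set \<open>C\<close> of \<open>A\<close>. By
  commutation \<open>t \<in> B\<close> maps \<open>C\<close> to itself, and \<open>t x\<close> is as far from \<open>q\<close> as \<open>x\<close>; the projection
  being unique, \<open>t x = x\<close>.\<close>

lemma commuting_fixed_point:
  fixes A B :: "('a::{cat0_space, complete_space} \<Rightarrow> 'a) set"
  assumes isom: "A \<subseteq> Isom" "B \<subseteq> Isom"
    and comm: "\<And>s t. s \<in> A \<Longrightarrow> t \<in> B \<Longrightarrow> s \<circ> t = t \<circ> s"
    and "has_fixed_point A" "has_fixed_point B"
  shows "has_fixed_point (A \<union> B)"
proof -
  obtain q where q: "\<And>t. t \<in> B \<Longrightarrow> t q = q"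
    using \<open>has_fixed_point B\<close> unfolding has_fixed_point_def by blast
  define C where "C = {x. \<forall>t\<in>A. t x = x}"
  have C: "closed C" "C \<noteq> {}"
    using common_fixed_points_closed[OF isom(1)] \<open>has_fixed_point A\<close>
    by (auto simp: C_def has_fixed_point_def)
  have conv: "midpoint_convex C"
    using isom cat0_midpoint_fixed by (fastforce simp: midpoint_convex_def C_def)
  let ?E = "energy {()} (\<lambda>_. 1) (\<lambda>_. q)"
  obtain x where x: "x \<in> C" "\<And>y. y \<in> C \<Longrightarrow> ?E x \<le> ?E y"
    by (rule energy_minimizer_exists[OF C conv, of "{()}" "\<lambda>_. 1" "\<lambda>_. q"]) auto
  have B_fixes: "t x = x" if t: "t \<in> B" for t
  proof -
    have "s (t x) = t x" if "s \<in> A" for s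
    proof -
      have "s (t x) = t (s x)"
        using comm[OF that t] by (metis comp_apply)
      moreover have "s x = x"
        using x(1) that by (simp add: C_def)
      ultimately show ?thesis
        by simp
    qed
    then have "t x \<in> C"
      by (simp add: C_def)
    have "dist (t x) (t q) = dist x q"
      using t isom by (auto simp: Isom_def)
    then have "?E (t x) = ?E x"
      using q[OF t] by (simp add: energy_def)
    then have "(dist (t x) x)\<^sup>2 \<le> 0"
      using energy_gap[OF conv \<open>t x \<in> C\<close> x(1), of "{()}" "\<lambda>_. 1" "?E x" "\<lambda>_. q"] x(2) by simp
    then show ?thesis
      by simp
  qed
  have "t x = x" if "t \<in> A \<union> B" for t
    using that
  proof
    show "t x = x" if "t \<in> A"
      using x(1) that by (simp add: C_def)
  qed (rule B_fixes)
  then have "\<forall>t\<in>A \<union> B. t x = x"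
    by (rule ballI)
  then show ?thesis
    unfolding has_fixed_point_def by (rule exI)
qed

lemma commuting_family_fixed_point:
  fixes A :: "'i \<Rightarrow> ('a::{cat0_space, complete_space} \<Rightarrow> 'a) set"
  assumes "finite I" and "\<And>i. i \<in> I \<Longrightarrow> A i \<subseteq> Isom"
    and "\<And>i j s t. i \<in> I \<Longrightarrow> j \<in> I \<Longrightarrow> i \<noteq> j \<Longrightarrow> s \<in> A i \<Longrightarrow> t \<in> A j \<Longrightarrow> s \<circ> t = t \<circ> s"
    and "\<And>i. i \<in> I \<Longrightarrow> has_fixed_point (A i)"
  shows "has_fixed_point (\<Union>i\<in>I. A i)"
  using assms
proof (induction I)
  case empty
  then show ?case
    by (simp add: has_fixed_point_def)
next
  case (insert j I)
  have "has_fixed_point (A j \<union> (\<Union>i\<in>I. A i))"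
  proof (rule commuting_fixed_point)
    show "has_fixed_point (\<Union>i\<in>I. A i)"
    proof (rule insert.IH)
      show "s \<circ> t = t \<circ> s"
        if "i \<in> I" "i' \<in> I" "i \<noteq> i'" "s \<in> A i" "t \<in> A i'" for i i' s t
        by (rule insert.prems(2)[of i i']) (use that in simp_all)
    qed (use insert.prems(1,3) in simp_all)
    show "s \<circ> t = t \<circ> s" if "s \<in> A j" "t \<in> (\<Union>i\<in>I. A i)" for s t
    proof -
      from that(2) obtain i where "i \<in> I" "t \<in> A i"
        by blast
      moreover from \<open>i \<in> I\<close> insert.hyps(2) have "j \<noteq> i"
        by blast
      ultimately show ?thesis
        using \<open>i \<in> I\<close>
        by (intro insert.prems(2)[of j i s t]) (use that(1) in simp_all)
    qed
    show "A j \<subseteq> Isom" "has_fixed_point (A j)" "(\<Union>i\<in>I. A i) \<subseteq> Isom"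
      using insert.prems(1,3) by auto
  qed
  then show ?case
    by simp
qed

section \<open>Self-maps of spheres\<close>

lemma nsphere_eq_top_of_set:
  "nsphere d = top_of_set {x. (\<Sum>i\<le>d. (x i)\<^sup>2) = 1 \<and> (\<forall>i>d. x i = 0)}"
  by (simp add: nsphere flip: euclidean_product_topology)

lemma continuous_map_normalise:
  fixes q :: "'z::topological_space \<Rightarrow> nat \<Rightarrow> real"
  assumes cont: "\<And>i. continuous_on S (\<lambda>z. q z i)"
    and zero: "\<And>z i. z \<in> S \<Longrightarrow> d < i \<Longrightarrow> q z i = 0"
    and nz: "\<And>z. z \<in> S \<Longrightarrow> \<exists>i\<le>d. q z i \<noteq> 0"
  shows "continuous_map (top_of_set S) (nsphere d)
           (\<lambda>z i. q z i / sqrt (\<Sum>j\<le>d. (q z j)\<^sup>2))"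
proof -
  have pos: "0 < (\<Sum>j\<le>d. (q z j)\<^sup>2)" if z: "z \<in> S" for z
  proof -
    obtain i where "i \<le> d" "q z i \<noteq> 0"
      using nz[OF z] by blast
    then show ?thesis
      by (intro sum_pos2[of _ i]) auto
  qed
  have "continuous_on S (\<lambda>z i. q z i / sqrt (\<Sum>j\<le>d. (q z j)\<^sup>2))"
    using pos by (intro continuous_on_coordinatewise_then_product continuous_intros cont)
      (metis less_irrefl real_sqrt_eq_zero_cancel_iff)
  moreover have "(\<Sum>i\<le>d. (q z i / sqrt (\<Sum>j\<le>d. (q z j)\<^sup>2))\<^sup>2) = 1" if "z \<in> S" for z
    using pos[OF that]
    by (simp add: power_divide flip: sum_divide_distrib)
  ultimately show ?thesis
    using zero by (auto simp: nsphere_eq_top_of_set)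
qed

text \<open>If \<open>h y\<close> is never the antipode of \<open>y\<close>, the segment from \<open>h y\<close> to \<open>y\<close> misses the origin, and
  its radial projection is a homotopy from \<open>h\<close> to the identity. If \<open>h\<close> were also null-homotopic,
  the sphere would be contractible.\<close>

lemma nullhomotopic_nsphere_antipode:
  assumes null: "homotopic_with (\<lambda>_. True) (nsphere d) (nsphere d) h (\<lambda>_. c)"
  obtains y where "y \<in> topspace (nsphere d)" "\<And>i. h y i = - y i"
proof (rule ccontr)
  assume "\<not> thesis"
  then have anti: "\<exists>i. h y i \<noteq> - y i" if "y \<in> topspace (nsphere d)" for y
    using that \<open>\<And>y. \<lbrakk>y \<in> topspace (nsphere d); \<And>i. h y i = - y i\<rbrakk> \<Longrightarrow> thesis\<close> by blast
  define N where "N = {x::nat \<Rightarrow> real. (\<Sum>i\<le>d. (x i)\<^sup>2) = 1 \<and> (\<forall>i>d. x i = 0)}"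
  have nsphere_N: "nsphere d = top_of_set N"
    by (simp add: N_def nsphere_eq_top_of_set)
  have "continuous_map (nsphere d) (nsphere d) h"
    using null homotopic_with_imp_continuous_maps by blast
  then have hcont: "continuous_on N h" and hN: "\<And>y. y \<in> N \<Longrightarrow> h y \<in> N"
    by (auto simp: nsphere_N)
  define q where "q = (\<lambda>(t, y) i. (1 - t) * h y i + t * y i :: real)"
  have nz: "\<exists>i\<le>d. q (t, y) i \<noteq> 0" if t: "t \<in> {0..1}" and y: "y \<in> N" for t y
  proof (rule ccontr)
    assume "\<not> ?thesis"
    then have 0: "(1 - t) * h y i = - (t * y i)" if "i \<le> d" for i
      using that by (force simp: q_def)
    \<comment> \<open>Both ends have norm 1, so a segment through the origin meets it in its middle.\<close>
    have "(1 - t)\<^sup>2 * (\<Sum>i\<le>d. (h y i)\<^sup>2) = t\<^sup>2 * (\<Sum>i\<le>d. (y i)\<^sup>2)"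
      unfolding sum_distrib_left by (intro sum.cong) (metis 0 atMost_iff power2_minus power_mult_distrib)+
    then have "(1 - t)\<^sup>2 = t\<^sup>2"
      using y hN[OF y] by (simp add: N_def)
    then have "t = 1 / 2"
      by (simp add: power2_eq_square algebra_simps)
    then have "h y i = - y i" if "i \<le> d" for i
      using 0[OF that] unfolding \<open>t = 1 / 2\<close> by simp
    moreover have "h y i = - y i" if "i > d" for i
      using y hN[OF y] that by (simp add: N_def)
    ultimately have "\<forall>i. h y i = - y i"
      by (metis linorder_not_le)
    then show False
      using anti[of y] y by (simp add: nsphere_N)
  qed
  have "continuous_map (top_of_set ({0..1} \<times> N)) (nsphere d)
      (\<lambda>z i. q z i / sqrt (\<Sum>j\<le>d. (q z j)\<^sup>2))"
  proof (rule continuous_map_normalise)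
    fix i
    have "continuous_on ({0..1} \<times> N) (\<lambda>z. h (snd z) i)"
      by (rule continuous_on_compose2[OF continuous_on_product_then_coordinatewise[OF hcont],
            where f = snd])
        (auto intro: continuous_on_snd continuous_on_id)
    moreover have "continuous_on ({0..1} \<times> N) (\<lambda>z. snd z i)"
      by (rule continuous_on_compose2[OF continuous_on_product_coordinates,
            where f = snd])
        (auto intro: continuous_on_snd continuous_on_id)
    ultimately show "continuous_on ({0..1} \<times> N) (\<lambda>z. q z i)"
      unfolding q_def case_prod_unfold by (intro continuous_intros)
  next
    fix z :: "real \<times> (nat \<Rightarrow> real)" and i
    assume "z \<in> {0..1} \<times> N" "d < i"
    then show "q z i = 0"
      using hN by (auto simp: q_def N_def)
  qed (use nz in auto)
  moreover have "q (0, y) i / sqrt (\<Sum>j\<le>d. (q (0, y) j)\<^sup>2) = h y i"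
    "q (1, y) i / sqrt (\<Sum>j\<le>d. (q (1, y) j)\<^sup>2) = y i" if "y \<in> N" for y i
    using that hN[OF that] by (simp_all add: q_def N_def)
  ultimately have "homotopic_with (\<lambda>_. True) (nsphere d) (nsphere d) h id"
    unfolding nsphere_N
    by (subst homotopic_with) (auto intro!: exI[of _ "\<lambda>z i. q z i / sqrt (\<Sum>j\<le>d. (q z j)\<^sup>2)"])
  then have "homotopic_with (\<lambda>_. True) (nsphere d) (nsphere d) id (\<lambda>_. c)"
    using null homotopic_with_symD homotopic_with_trans by blast
  then show False
    using non_contractible_space_nsphere by (auto simp: contractible_space_def)
qed

section \<open>The boundary of a product of simplices\<close>

text \<open>The affine space of the simplex with vertex set \<open>T i\<close> is described by functions \<open>Y i\<close> on
  \<open>T i\<close> up to an additive constant. For a direction \<open>Y\<close> in the product of these spaces,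
  \<open>boundary_weight\<close> picks, by a choice of these constants, homogeneous barycentric coordinates of
  a boundary point of the product: all weights are nonnegative, each factor
  has a positive one unless \<open>Y\<close> is constant in all factors, and some factor has a zero one. This is
  achieved by giving the largest entries of all factors the same weight, which is the largest
  difference of two entries in a common factor.\<close>

definition spread :: "'i set \<Rightarrow> ('i \<Rightarrow> 'b set) \<Rightarrow> ('i \<Rightarrow> 'b \<Rightarrow> real) \<Rightarrow> real" where
  "spread I T Y = Max ((\<lambda>(i, s, s'). Y i s' - Y i s) ` (SIGMA i:I. T i \<times> T i))"

definition boundary_weight ::
    "'i set \<Rightarrow> ('i \<Rightarrow> 'b set) \<Rightarrow> ('i \<Rightarrow> 'b \<Rightarrow> real) \<Rightarrow> 'i \<Rightarrow> 'b \<Rightarrow> real" where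
  "boundary_weight I T Y i s = spread I T Y - (Max (Y i ` T i) - Y i s)"

context
  fixes I :: "'i set" and T :: "'i \<Rightarrow> 'b set"
  assumes I: "finite I" "I \<noteq> {}"
    and T: "\<And>i. i \<in> I \<Longrightarrow> finite (T i)" "\<And>i. i \<in> I \<Longrightarrow> T i \<noteq> {}"
begin

lemma spread_ge:
  assumes "i \<in> I" "s \<in> T i" "s' \<in> T i"
  shows "Y i s' - Y i s \<le> spread I T Y"
  unfolding spread_def
proof (rule Max_ge)
  show "Y i s' - Y i s \<in> (\<lambda>(i, s, s'). Y i s' - Y i s) ` (SIGMA i:I. T i \<times> T i)"
    using assms by force
qed (use I T in auto)

lemma spread_pos:
  assumes "i \<in> I" "s \<in> T i" "s' \<in> T i" "Y i s \<noteq> Y i s'"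
  shows "0 < spread I T Y"
  using assms spread_ge[of i s s' Y] spread_ge[of i s' s Y] by linarith

lemma boundary_weight_nonneg:
  assumes "i \<in> I" "s \<in> T i"
  shows "0 \<le> boundary_weight I T Y i s"
proof -
  have "Max (Y i ` T i) \<in> Y i ` T i"
    using assms T by (intro Max_in) auto
  then obtain s' where "s' \<in> T i" "Max (Y i ` T i) = Y i s'"
    by auto
  then show ?thesis
    using spread_ge[OF assms, of s' Y] by (simp add: boundary_weight_def)
qed

lemma boundary_weight_eq_spread:
  assumes "i \<in> I"
  obtains s where "s \<in> T i" "boundary_weight I T Y i s = spread I T Y"
proof -
  have "Max (Y i ` T i) \<in> Y i ` T i"
    using assms T by (intro Max_in) auto
  then obtain s where "s \<in> T i" "Max (Y i ` T i) = Y i s"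
    by auto
  then show thesis
    using that[of s] by (simp add: boundary_weight_def)
qed

text \<open>In a factor where the spread is attained, the smallest entry has weight zero. Within a factor,
  weights and entries of \<open>Y\<close> differ by a constant, so positive weight means a larger entry.\<close>

lemma boundary_weight_eq_0:
  obtains i s where "i \<in> I" "s \<in> T i" "boundary_weight I T Y i s = 0"
    and "\<And>s'. s' \<in> T i \<Longrightarrow> boundary_weight I T Y i s' \<noteq> 0 \<Longrightarrow> Y i s < Y i s'"
proof -
  have "spread I T Y \<in> (\<lambda>(i, s, s'). Y i s' - Y i s) ` (SIGMA i:I. T i \<times> T i)"
    unfolding spread_def using I T by (intro Max_in) auto
  then obtain i s s' where *: "i \<in> I" "s \<in> T i" "s' \<in> T i" "spread I T Y = Y i s' - Y i s"
    by auto
  have "Y i s' \<le> Max (Y i ` T i)"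
    using * T by (intro Max_ge) auto
  then have 0: "boundary_weight I T Y i s = 0"
    using * boundary_weight_nonneg[of i s Y] by (simp add: boundary_weight_def)
  have "Y i s < Y i r" if "r \<in> T i" "boundary_weight I T Y i r \<noteq> 0" for r
    using that boundary_weight_nonneg[OF *(1) that(1), of Y] 0 by (simp add: boundary_weight_def)
  with * 0 show thesis
    using that by blast
qed

end

lemma continuous_on_Max_image:
  fixes f :: "'b \<Rightarrow> 'z::topological_space \<Rightarrow> real"
  assumes "finite A" "A \<noteq> {}" and "\<And>a. a \<in> A \<Longrightarrow> continuous_on S (f a)"
  shows "continuous_on S (\<lambda>z. Max ((\<lambda>a. f a z) ` A))"
  using assms
proof (induction A rule: finite_ne_induct)
  case (insert a A)
  then show ?case
    by (simp add: continuous_on_max)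
qed simp

lemma continuous_on_boundary_weight:
  fixes Y :: "'z::topological_space \<Rightarrow> 'i \<Rightarrow> 'b \<Rightarrow> real"
  assumes I: "finite I" and T: "\<And>i. i \<in> I \<Longrightarrow> finite (T i)"
    and cont: "\<And>i s. i \<in> I \<Longrightarrow> s \<in> T i \<Longrightarrow> continuous_on S (\<lambda>z. Y z i s)"
    and "i \<in> I" "s \<in> T i"
  shows "continuous_on S (\<lambda>z. boundary_weight I T (Y z) i s)"
proof -
  let ?J = "SIGMA i:I. T i \<times> T i"
  have "continuous_on S (\<lambda>z. Max ((\<lambda>j. Y z (fst j) (snd (snd j)) - Y z (fst j) (fst (snd j))) ` ?J))"
  proof (rule continuous_on_Max_image)
    have "(i, s, s) \<in> ?J"
      using assms(4,5) by blast
    then show "?J \<noteq> {}"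
      by blast
  qed (use I T cont in \<open>auto intro!: continuous_intros\<close>)
  then have "continuous_on S (\<lambda>z. spread I T (Y z))"
    by (simp add: spread_def case_prod_unfold)
  moreover have "continuous_on S (\<lambda>z. Max ((\<lambda>s. Y z i s) ` T i))"
    using assms by (intro continuous_on_Max_image) auto
  ultimately show ?thesis
    unfolding boundary_weight_def using assms by (intro continuous_intros) auto
qed

section \<open>Critical families of isometries and dimension\<close>

text \<open>The topological heart of the argument, for families that have no fixed point but are minimal
  with this property. It produces a map into the sphere of dimension \<open>d\<close>, defined on a
  closed set, that cannot extend to the whole space.\<close>

lemma critical_families_dim:
  fixes T :: "'i \<Rightarrow> ('a::{cat0_space, complete_space} \<Rightarrow> 'a) set"
  assumes I: "finite I" "I \<noteq> {}"
    and T: "\<And>i. i \<in> I \<Longrightarrow> finite (T i)" "\<And>i. i \<in> I \<Longrightarrow> T i \<subseteq> Isom"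
    and comm: "\<And>i j s t. i \<in> I \<Longrightarrow> j \<in> I \<Longrightarrow> i \<noteq> j \<Longrightarrow> s \<in> T i \<Longrightarrow> t \<in> T j \<Longrightarrow> s \<circ> t = t \<circ> s"
    and nofix: "\<And>i. i \<in> I \<Longrightarrow> \<not> has_fixed_point (T i)"
    and crit: "\<And>i s. i \<in> I \<Longrightarrow> s \<in> T i \<Longrightarrow> has_fixed_point (T i - {s})"
    and d: "Suc d = (\<Sum>i\<in>I. card (T i) - 1)"
  shows "\<not> covering_dim_le (euclidean :: 'a topology) d"
proof
  assume dim: "covering_dim_le (euclidean :: 'a topology) d"
  have Tne: "T i \<noteq> {}" if "i \<in> I" for i
    using nofix[OF that] by (cases "T i = {}") (simp_all add: has_fixed_point_def)
  define A where "A = PiE I T"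
  have finA: "finite A"
    unfolding A_def using I T by (intro finite_PiE) auto
  have "\<exists>x. \<forall>i\<in>I. \<forall>t\<in>T i - {a i}. t x = x" if a: "a \<in> A" for a
  proof -
    have "has_fixed_point (\<Union>i\<in>I. T i - {a i})"
    proof (rule commuting_family_fixed_point)
      show "has_fixed_point (T i - {a i})" if "i \<in> I" for i
        using crit[OF that] a that by (auto simp: A_def)
      show "T i - {a i} \<subseteq> Isom" if "i \<in> I" for i
        using T(2)[OF that] by blast
      show "s \<circ> t = t \<circ> s"
        if "i \<in> I" "j \<in> I" "i \<noteq> j" "s \<in> T i - {a i}" "t \<in> T j - {a j}" for i j s t
        using comm[OF that(1-3)] that(4,5) by blast
    qed (fact I)
    then obtain x where x: "\<forall>t\<in>(\<Union>i\<in>I. T i - {a i}). t x = x"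
      unfolding has_fixed_point_def ..
    show ?thesis
    proof (intro exI ballI)
      show "t x = x" if "i \<in> I" "t \<in> T i - {a i}" for i t
        by (rule bspec[OF x]) (use that in blast)
    qed
  qed
  then obtain p where p: "\<And>a i t. a \<in> A \<Longrightarrow> i \<in> I \<Longrightarrow> t \<in> T i \<Longrightarrow> t \<noteq> a i \<Longrightarrow> t (p a) = p a"
    by (metis Diff_iff singletonD)

  \<comment> \<open>Functions on \<open>T i\<close> up to constants are represented by those vanishing at \<open>s0 i\<close>. The
    other entries, enumerated by \<open>e\<close>, are the coordinates of the ambient space of the sphere.\<close>
  define s0 where "s0 i = (SOME s. s \<in> T i)" for i
  have s0: "s0 i \<in> T i" if "i \<in> I" for i
    unfolding s0_def using Tne[OF that] by (rule some_in_eq[THEN iffD2])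
  define J where "J = (SIGMA i:I. T i - {s0 i})"
  have "card J = (\<Sum>i\<in>I. card (T i - {s0 i}))"
    unfolding J_def using I T by (intro card_SigmaI) auto
  also have "\<dots> = Suc d"
    unfolding d using s0 T by (intro sum.cong) (auto simp: card_Diff_singleton)
  finally have cardJ: "card J = Suc d" .
  then obtain e where "bij_betw e J {0..<Suc d}"
    using ex_bij_betw_finite_nat[of J] by (metis card.infinite nat.distinct(1))
  then have e: "bij_betw e J {..d}"
    by (simp add: atLeast0LessThan lessThan_Suc_atMost)
  define Y where "Y y i s = (if s = s0 i then 0 else y (e (i, s)))" for y :: "nat \<Rightarrow> real" and i s

  \<comment> \<open>The map from \<open>K\<close> to the sphere. On \<open>K\<close> some displacement is zero while another one in the
    same factor is not, so the displacements of that factor are not constant.\<close>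
  define u where "u s x = dist x (s x)" for s and x :: 'a
  define K where "K = {x. \<exists>i\<in>I. \<exists>s\<in>T i. s x = x}"
  have conts: "continuous_on UNIV s" if "i \<in> I" "s \<in> T i" for i s
    using that T(2) by (auto intro: Isom_continuous_on)
  have "closed (\<Union>i\<in>I. \<Union>s\<in>T i. {x. s x = x})"
    using I T conts by (intro closed_UN ballI closed_Collect_eq continuous_on_id) auto
  moreover have "(\<Union>i\<in>I. \<Union>s\<in>T i. {x. s x = x}) = K"
    by (auto simp: K_def)
  ultimately have "closed K"
    by simp
  define q where "q x l = (if l \<le> d then
      let (i, s) = inv_into J e l in u s x - u (s0 i) x else 0)" for x l
  have Yq: "Y (q x) i s = u s x - u (s0 i) x" if "i \<in> I" "s \<in> T i" for x i s
  proof (cases "s = s0 i")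
    case False
    then have "(i, s) \<in> J"
      using that by (simp add: J_def)
    then have "e (i, s) \<le> d" "inv_into J e (e (i, s)) = (i, s)"
      using e by (auto simp: bij_betw_def)
    then show ?thesis
      using False by (simp add: Y_def q_def)
  qed (simp add: Y_def)
  have Y0: "Y y i s = 0" if "\<And>l. l \<le> d \<Longrightarrow> y l = 0" "i \<in> I" "s \<in> T i" for y i s
    using that e by (auto simp: Y_def J_def bij_betw_def)
  have moved: "\<exists>s\<in>T i. s x \<noteq> x" if "i \<in> I" for i x
    using nofix[OF that] unfolding has_fixed_point_def by simp
  have qnz: "\<exists>l\<le>d. q x l \<noteq> 0" if "x \<in> K" for x
  proof (rule ccontr)
    assume "\<not> ?thesis"
    then have 0: "u s x = u (s0 i) x" if "i \<in> I" "s \<in> T i" for i s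
      using Y0[of "q x" i s] Yq[of i s x] that by auto
    obtain i s where "i \<in> I" "s \<in> T i" "s x = x"
      using \<open>x \<in> K\<close> by (auto simp: K_def)
    moreover obtain s' where "s' \<in> T i" "s' x \<noteq> x"
      using moved \<open>i \<in> I\<close> by blast
    ultimately show False
      using 0[of i s] 0[of i s'] by (simp add: u_def)
  qed
  define f where "f x l = q x l / sqrt (\<Sum>j\<le>d. (q x j)\<^sup>2)" for x l
  have "continuous_map (top_of_set K) (nsphere d) f"
    unfolding f_def
  proof (rule continuous_map_normalise)
    fix l
    show "continuous_on K (\<lambda>x. q x l)"
    proof (cases "l \<le> d")
      case True
      obtain i s where idx: "inv_into J e l = (i, s)"
        by force
      have "(i, s) \<in> J"
        unfolding idx[symmetric] using True e by (intro inv_into_into) (auto simp: bij_betw_def)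
      then have "i \<in> I" "s \<in> T i" "s0 i \<in> T i"
        using s0 by (auto simp: J_def)
      then have "continuous_on K s" "continuous_on K (s0 i)"
        using conts continuous_on_subset by blast+
      then show ?thesis
        using True by (auto simp: q_def idx u_def intro!: continuous_intros)
    qed (simp add: q_def)
  qed (use qnz in \<open>auto simp: q_def\<close>)
  then obtain g where g: "continuous_map euclidean (nsphere d) g" "\<And>x. x \<in> K \<Longrightarrow> g x = f x"
    using dim \<open>closed K\<close> unfolding covering_dim_le_def by (metis closed_closedin order_refl)

  define N where "N = topspace (nsphere d)"
  have N: "N = {x. (\<Sum>i\<le>d. (x i)\<^sup>2) = 1 \<and> (\<forall>i>d. x i = 0)}" "nsphere d = top_of_set N"
    by (simp_all add: N_def nsphere_eq_top_of_set)
  let ?\<beta> = "\<lambda>y. boundary_weight I T (Y y)"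
  have spread: "0 < spread I T (Y y)" if "y \<in> N" for y
  proof -
    have "\<exists>l\<le>d. y l \<noteq> 0"
    proof (rule ccontr)
      assume "\<not> ?thesis"
      then show False
        using \<open>y \<in> N\<close> by (simp add: N(1))
    qed
    then obtain l where l: "l \<le> d" "y l \<noteq> 0"
      by blast
    then have "l \<in> e ` J"
      using e by (simp add: bij_betw_def)
    then obtain i s where "i \<in> I" "s \<in> T i" "s \<noteq> s0 i" "l = e (i, s)"
      by (auto simp: J_def)
    then show ?thesis
      using l s0
      by (intro spread_pos[where I = I and T = T and i = i and s = s and s' = "s0 i",
            OF I T(1) Tne])
        (auto simp: Y_def)
  qed
  \<comment> \<open>At \<open>t = 1\<close> the weights of a boundary point of the product of simplices, at \<open>t = 0\<close> those
    of its centre. A vertex of the product has as its weight the product of the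
    weights of its components.\<close>
  define W where "W = (\<lambda>(t, y) a. \<Prod>i\<in>I. (1 - t) + t * ?\<beta> y i (a i))"
  define \<phi> where "\<phi> z = barycenter A (W z) p" for z
  have Wnonneg: "0 \<le> W z a" if "z \<in> {0..1} \<times> N" "a \<in> A" for z a
    using that boundary_weight_nonneg[where I = I and T = T, OF I T(1) Tne]
    by (auto simp: W_def A_def intro!: prod_nonneg add_nonneg_nonneg mult_nonneg_nonneg)
  have Wpos: "0 < sum (W z) A" if z: "z \<in> {0..1} \<times> N" for z
  proof -
    obtain t y where ty: "z = (t, y)" "0 \<le> t" "t \<le> 1" "y \<in> N"
      using z by auto
    have "\<exists>s\<in>T i. ?\<beta> y i s = spread I T (Y y)" if "i \<in> I" for i
      using boundary_weight_eq_spread[where I = I and T = T, OF I T(1) Tne that] by metis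
    then obtain b where b: "\<And>i. i \<in> I \<Longrightarrow> b i \<in> T i" "\<And>i. i \<in> I \<Longrightarrow> ?\<beta> y i (b i) = spread I T (Y y)"
      by metis
    have "0 < (1 - t) + t * spread I T (Y y)"
      using ty spread[of y] by (cases "t = 1") (auto intro: add_pos_nonneg)
    then have "0 < W z (restrict b I)"
      unfolding W_def ty(1) by (auto simp: b intro!: prod_pos)
    moreover have "restrict b I \<in> A"
      using b by (simp add: A_def)
    ultimately show ?thesis
      using finA Wnonneg[OF z] by (intro sum_pos2)
  qed
  have Wcont: "continuous_on ({0..1} \<times> N) (\<lambda>z. W z a)" if "a \<in> A" for a
  proof -
    have Ycont: "continuous_on ({0..1::real} \<times> N) (\<lambda>z. Y (snd z) i s)" for i s
    proof (cases "s = s0 i")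
      case False
      have "continuous_on ({0..1::real} \<times> N) (\<lambda>z. snd z (e (i, s)))"
        by (rule continuous_on_compose2[OF continuous_on_product_coordinates,
              where f = snd])
          (auto intro: continuous_on_snd continuous_on_id)
      then show ?thesis
        using False by (simp add: Y_def)
    qed (simp add: Y_def)
    have "continuous_on ({0..1} \<times> N) (\<lambda>z. \<Prod>i\<in>I. (1 - fst z) + fst z * ?\<beta> (snd z) i (a i))"
      using that I T Ycont
      by (intro continuous_intros continuous_on_boundary_weight) (auto simp: A_def)
    then show ?thesis
      by (simp add: W_def case_prod_unfold)
  qed
  have \<phi>cont: "continuous_on ({0..1} \<times> N) \<phi>"
    unfolding \<phi>_def using finA Wcont Wnonneg Wpos by (rule continuous_on_barycenter)

  \<comment> \<open>Moving to the centre of the product makes the self-map \<open>h\<close> of the sphere null-homotopic.\<close>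
  define h where "h y = g (\<phi> (1, y))" for y
  define c where "c = g (barycenter A (\<lambda>_. 1) p)"
  have "continuous_map (top_of_set ({0..1} \<times> N)) (nsphere d) (g \<circ> \<phi>)"
    using \<phi>cont g(1) by (intro continuous_map_compose[where X' = euclidean]) auto
  then have "homotopic_with (\<lambda>_. True) (nsphere d) (nsphere d) (\<lambda>_. c) h"
    unfolding N(2)
    by (subst homotopic_with)
      (auto simp: h_def c_def \<phi>_def W_def intro!: exI[of _ "g \<circ> \<phi>"])
  then obtain y where y: "y \<in> N" "\<And>i. h y i = - y i"
    using nullhomotopic_nsphere_antipode homotopic_with_symD unfolding N_def by metis

  \<comment> \<open>At the point \<open>y\<close> with antipodal image, compare the entries at \<open>s\<close>, of weight zero, and at an
    \<open>s'\<close> of the same factor that moves \<open>x\<close>: both \<open>y\<close> and \<open>h y\<close> are larger at \<open>s'\<close>.\<close>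
  define x where "x = \<phi> (1, y)"
  have fixed: "s x = x" if "i \<in> I" "s \<in> T i" "?\<beta> y i s = 0" for i s
    unfolding x_def \<phi>_def
  proof (rule barycenter_fixed)
    show "s (p a) = p a" if a: "a \<in> A" "W (1, y) a \<noteq> 0" for a
    proof -
      have "?\<beta> y i (a i) \<noteq> 0"
        using a \<open>i \<in> I\<close> I by (auto simp: W_def)
      then show ?thesis
        using p[OF a(1) \<open>i \<in> I\<close> \<open>s \<in> T i\<close>] \<open>?\<beta> y i s = 0\<close> by metis
    qed
  qed (use that T Wnonneg Wpos y in auto)
  obtain i s where idx: "i \<in> I" "s \<in> T i" "?\<beta> y i s = 0"
    and less: "\<And>s'. s' \<in> T i \<Longrightarrow> ?\<beta> y i s' \<noteq> 0 \<Longrightarrow> Y y i s < Y y i s'"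
    using boundary_weight_eq_0[where I = I and T = T and Y = "Y y", OF I T(1) Tne] by metis
  have sx: "s x = x"
    using fixed idx by blast
  then have "x \<in> K"
    using idx by (auto simp: K_def)
  obtain s' where s': "s' \<in> T i" "s' x \<noteq> x"
    using moved idx by blast
  then have lt: "Y y i s < Y y i s'"
    using less fixed idx by metis
  define r where "r = sqrt (\<Sum>j\<le>d. (q x j)\<^sup>2)"
  have "0 \<le> r"
    by (simp add: r_def sum_nonneg)
  have neg: "- Y y i v = Y (q x) i v / r" for v
    using y(2) g(2)[OF \<open>x \<in> K\<close>] by (simp add: Y_def f_def r_def h_def flip: x_def)
  have "Y y i s - Y y i s' = Y (q x) i s' / r - Y (q x) i s / r"
    using neg[of s] neg[of s'] by linarith
  also have "\<dots> = (u s' x - u s x) / r"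
    using Yq[of i s x] Yq[of i s' x] idx s' by (simp flip: diff_divide_distrib)
  finally have "0 \<le> Y y i s - Y y i s'"
    using \<open>0 \<le> r\<close> sx by (simp add: u_def)
  with lt show False
    by simp
qed

lemma critical_subset:
  assumes "finite T" "\<not> has_fixed_point T"
  shows "\<exists>R\<subseteq>T. \<not> has_fixed_point R \<and> (\<forall>s\<in>R. has_fixed_point (R - {s}))"
  using assms
proof (induction T rule: finite_psubset_induct)
  case (psubset T)
  show ?case
  proof (cases "\<forall>s\<in>T. has_fixed_point (T - {s})")
    case True
    with psubset.prems show ?thesis
      by (intro exI[of _ T]) simp
  next
    case False
    then obtain s where "s \<in> T" "\<not> has_fixed_point (T - {s})"
      by blast
    then obtain R where "R \<subseteq> T - {s}"
        "\<not> has_fixed_point R \<and> (\<forall>s\<in>R. has_fixed_point (R - {s}))"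
      using psubset.IH[of "T - {s}"] by blast
    then show ?thesis
      by (intro exI[of _ R]) blast
  qed
qed

theorem proposition3:
  fixes n :: nat
    and k :: "nat \<Rightarrow> nat"
    and S :: "nat \<Rightarrow> ('a::{cat0_space, complete_space} \<Rightarrow> 'a) set"
  assumes "n \<ge> 1"
    and "\<And>i. i \<in> {1..n} \<Longrightarrow> k i > 0"
    and "covering_dim (euclidean :: 'a topology) < enat (\<Sum>i=1..n. k i)"
    and "\<And>i. i \<in> {1..n} \<Longrightarrow> S i \<subseteq> Isom"
    and "\<And>i j s t. i \<in> {1..n} \<Longrightarrow> j \<in> {1..n} \<Longrightarrow> i \<noteq> j \<Longrightarrow> s \<in> S i \<Longrightarrow> t \<in> S j \<Longrightarrow>
           s \<circ> t = t \<circ> s"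
    and "\<And>i T. i \<in> {1..n} \<Longrightarrow> T \<subseteq> S i \<Longrightarrow> finite T \<Longrightarrow> card T \<le> k i \<Longrightarrow> has_fixed_point T"
  shows "\<exists>i\<in>{1..n}. \<forall>T. T \<subseteq> S i \<longrightarrow> finite T \<longrightarrow> has_fixed_point T"
proof (rule ccontr)
  assume "\<not> ?thesis"
  then have "\<exists>R. R \<subseteq> S i \<and> finite R \<and> \<not> has_fixed_point R \<and> (\<forall>s\<in>R. has_fixed_point (R - {s}))"
    if "i \<in> {1..n}" for i
    using that by (metis critical_subset finite_subset order_trans)
  then obtain T where T: "\<And>i. i \<in> {1..n} \<Longrightarrow> T i \<subseteq> S i" "\<And>i. i \<in> {1..n} \<Longrightarrow> finite (T i)"
      "\<And>i. i \<in> {1..n} \<Longrightarrow> \<not> has_fixed_point (T i)"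
      "\<And>i s. i \<in> {1..n} \<Longrightarrow> s \<in> T i \<Longrightarrow> has_fixed_point (T i - {s})"
    by metis
  have "k i \<le> card (T i) - 1" if "i \<in> {1..n}" for i
    using assms(6)[OF that T(1)[OF that] T(2)[OF that]] T(3)[OF that] by linarith
  then have le: "(\<Sum>i=1..n. k i) \<le> (\<Sum>i=1..n. card (T i) - 1)"
    by (rule sum_mono)
  obtain d0 where d0: "covering_dim_le (euclidean :: 'a topology) d0" "d0 < (\<Sum>i=1..n. k i)"
    using assms(3) by (auto simp: covering_dim_def INF_less_iff)
  obtain d where d: "Suc d = (\<Sum>i=1..n. card (T i) - 1)"
    using d0(2) le by (metis gr_implies_not0 less_le_trans not0_implies_Suc)
  have "d0 \<le> d"
    using d d0(2) le by linarith
  then have "covering_dim_le (euclidean :: 'a topology) d"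
    using d0(1) by (meson covering_dim_le_def order_trans)
  moreover have "\<not> covering_dim_le (euclidean :: 'a topology) d"
  proof (rule critical_families_dim[where I = "{1..n}" and T = T])
    show "T i \<subseteq> Isom" if "i \<in> {1..n}" for i
      using T(1) assms(4) that by blast
    show "s \<circ> t = t \<circ> s"
      if "i \<in> {1..n}" "j \<in> {1..n}" "i \<noteq> j" "s \<in> T i" "t \<in> T j" for i j s t
      using assms(5)[OF that(1-3)] T(1) that by blast
  qed (use assms(1) T d in auto)
  ultimately show False
    by blast
qed

end
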